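(* Let $n$ be a positive integer. Then \[ \sum_{\gamma \in D_n} (-1)^{\ell_D(\gamma)}q^{\operatorname{Dmaj}(\gamma)}= \begin{cases} [2]_{-q}[4]_{q}\cdots[2n-2]_{-q}\,[n]_{q} & \text{if $n$ is even,} \\ [2]_{-q}[4]_{q}\cdots[2n-2]_{q} \, [n]_{q} & \text{if $n$ is odd,} \end{cases} \] where in both cases the first $n-1$ factors are $[2i]_{(-1)^i q}$ for $i=1,\dots,n-1$.
   Context: For a positive integer $m$, $[m]_q:=\frac{1-q^m}{1-q}=1+q+\dots+q^{m-1}$, and $[m]_{-q}$ is obtained by substituting $-q$ for $q$. $B_n$ is the group of bijections $\beta$ of $[-n,n]\setminus\{0\}$ with $\beta(-i)=-\beta(i)$, written in window notation $\beta=[\beta_1,\dots,\beta_n]$ with $\beta_i=\beta(i)$. For $\beta\in B_n$: $\operatorname{inv}(\beta)=|\{(i,j): 1\le i<j\le n,\ \beta_i>\beta_j\}|$ (usual order on integers); $\operatorname{N}_1(\beta)=|\{i\in[n]:\beta_i<0\}|$; $\operatorname{N}_2(\beta)=|\{\{i,j\}: i\neq j\in[n],\ \beta_i+\beta_j<0\}|$. The descent set $\operatorname{Des}(\beta)$ is the set of $i\in[n-1]$ with $\beta_i\succ\beta_{i+1}$, where $\prec$ is the total order $-1\prec-2\prec\cdots\prec-n\prec 1\prec 2\prec\cdots\prec n$; $\operatorname{maj}(\beta)=\sum_{i\in\operatorname{Des}(\beta)}i$ and the flag-major index is $\operatorname{fmaj}(\beta)=2\operatorname{maj}(\beta)+\operatorname{N}_1(\beta)$.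 $D_n=\{\gamma\in B_n:\operatorname{N}_1(\gamma)\text{ even}\}$, with Coxeter length $\ell_D(\gamma)=\operatorname{inv}(\gamma)+\operatorname{N}_2(\gamma)$. For $\gamma\in D_n$, let $|\gamma|_n=[\gamma_1,\dots,\gamma_{n-1},|\gamma_n|]\in B_n$ and define the $D$-major index $\operatorname{Dmaj}(\gamma)=\operatorname{fmaj}(|\gamma|_n)$. *)

theory Defs
  imports "HOL-Combinatorics.Permutations"
begin

text \<open>A signed permutation is a function on all integers that is the identity outside
  \<open>{-n..n} - {0}\<close>, so that distinct functions are distinct group elements. Its \<open>i\<close>-th window
  entry is \<open>\<beta> (int i)\<close> for a natural number \<open>i \<in> {1..n}\<close>.\<close>

definition signed_perms :: "nat \<Rightarrow> (int \<Rightarrow> int) set" where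
  "signed_perms n = {\<beta>. \<beta> permutes ({- int n..int n} - {0}) \<and> (\<forall>i. \<beta> (- i) = - \<beta> i)}"

definition inv_count :: "nat \<Rightarrow> (int \<Rightarrow> int) \<Rightarrow> nat" where
  "inv_count n \<beta> = card {(i, j). 1 \<le> i \<and> i < j \<and> j \<le> n \<and> \<beta> (int i) > \<beta> (int j)}"

definition N1 :: "nat \<Rightarrow> (int \<Rightarrow> int) \<Rightarrow> nat" where
  "N1 n \<beta> = card {i \<in> {1..n}. \<beta> (int i) < 0}"

definition N2 :: "nat \<Rightarrow> (int \<Rightarrow> int) \<Rightarrow> nat" where
  "N2 n \<beta> = card {{i, j} | i j. i \<in> {1..n} \<and> j \<in> {1..n} \<and> i \<noteq> j \<and> \<beta> (int i) + \<beta> (int j) < 0}"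

text \<open>The order \<open>-1 \<prec> -2 \<prec> \<dots> \<prec> -n \<prec> 1 \<prec> 2 \<prec> \<dots> \<prec> n\<close> on nonzero integers; values at \<open>0\<close> are irrelevant.\<close>

definition prec :: "int \<Rightarrow> int \<Rightarrow> bool" (infix "\<prec>" 50) where
  "x \<prec> y \<longleftrightarrow> (x < 0 \<and> y < 0 \<and> \<bar>x\<bar> < \<bar>y\<bar>) \<or> (x < 0 \<and> 0 < y) \<or> (0 < x \<and> 0 < y \<and> x < y)"

definition Des :: "nat \<Rightarrow> (int \<Rightarrow> int) \<Rightarrow> nat set" where
  "Des n \<beta> = {i. 1 \<le> i \<and> i < n \<and> \<beta> (int (i + 1)) \<prec> \<beta> (int i)}"

definition maj :: "nat \<Rightarrow> (int \<Rightarrow> int) \<Rightarrow> nat" where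
  "maj n \<beta> = (\<Sum>i\<in>Des n \<beta>. i)"

definition fmaj :: "nat \<Rightarrow> (int \<Rightarrow> int) \<Rightarrow> nat" where
  "fmaj n \<beta> = 2 * maj n \<beta> + N1 n \<beta>"

definition even_signed_perms :: "nat \<Rightarrow> (int \<Rightarrow> int) set" where
  "even_signed_perms n = {\<gamma> \<in> signed_perms n. even (N1 n \<gamma>)}"

definition length_D :: "nat \<Rightarrow> (int \<Rightarrow> int) \<Rightarrow> nat" where
  "length_D n \<gamma> = inv_count n \<gamma> + N2 n \<gamma>"

text \<open>Replacing the last window entry by its absolute value forces the value at \<open>- n\<close>, by oddness.\<close>

definition abs_last :: "nat \<Rightarrow> (int \<Rightarrow> int) \<Rightarrow> (int \<Rightarrow> int)" where
  "abs_last n \<gamma> = \<gamma>(int n := \<bar>\<gamma> (int n)\<bar>, - int n := - \<bar>\<gamma> (int n)\<bar>)"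

definition Dmaj :: "nat \<Rightarrow> (int \<Rightarrow> int) \<Rightarrow> nat" where
  "Dmaj n \<gamma> = fmaj n (abs_last n \<gamma>)"

definition q_int :: "'a::comm_ring_1 \<Rightarrow> nat \<Rightarrow> 'a" where
  "q_int q m = (\<Sum>i<m. q ^ i)"

lemma q_int_quotient: "q \<noteq> 1 \<Longrightarrow> q_int q m = (1 - q ^ m) / (1 - q)" for q :: "'a::field"
  unfolding q_int_def by (simp add: sum_gp_strict)

end

theory Submission
  imports Defs
begin

text \<open>The parity of \<open>length_D\<close> is that of the number of inversions of \<open>\<bar>\<beta>\<bar>\<close>, so it does not change
  when the last sign is forgotten, and the sum becomes one over the \<open>\<beta> \<in> B\<^sub>n\<close> with \<open>\<beta>\<^sub>n > 0\<close>.
  Rotating the values one step downwards cyclically in the order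
  \<open>-1 \<prec> \<dots> \<prec> -n \<prec> 1 \<prec> \<dots> \<prec> n\<close> increases \<open>fmaj\<close> by one as long as \<open>\<beta>\<^sub>n \<noteq> -1\<close>, and multiplies the
  sign by \<open>(-1)\<^sup>n\<^sup>-\<^sup>1\<close>. Starting from the elements with \<open>\<beta>\<^sub>n = n\<close>, which form \<open>B\<^sub>n\<^sub>-\<^sub>1\<close>, the sum over
  \<open>B\<^sub>n\<close> is thus \<open>[2n]\<close> times the sum over \<open>B\<^sub>n\<^sub>-\<^sub>1\<close>, with only \<open>[n]\<close> appearing if
  \<open>\<beta>\<^sub>n > 0\<close> is required. This gives the product with \<open>(-1)\<^sup>i\<^sup>-\<^sup>1q\<close> in place of \<open>(-1)\<^sup>iq\<close>; the two agree
  because \<open>[2i]\<^sub>\<plusminus>\<^sub>q = (1 \<plusminus> q) [i]\<close> with \<open>[i]\<close> taken at \<open>q\<^sup>2\<close>.\<close>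

section \<open>Signed permutations\<close>

lemma signed_permsD:
  assumes "\<beta> \<in> signed_perms n"
  shows "\<beta> permutes ({- int n..int n} - {0})" "\<And>i. \<beta> (- i) = - \<beta> i" "inj \<beta>"
  using assms by (auto simp: signed_perms_def permutes_inj)

lemma signed_perms_window:
  assumes "\<beta> \<in> signed_perms n" "1 \<le> i" "i \<le> n"
  shows "\<beta> (int i) \<noteq> 0" "\<bar>\<beta> (int i)\<bar> \<le> int n"
  using permutes_in_image[OF signed_permsD(1)[OF assms(1)], of "int i"] assms by auto

lemma signed_perms_abs_eq_iff:
  assumes "\<beta> \<in> signed_perms n"
  shows "\<bar>\<beta> x\<bar> = \<bar>\<beta> y\<bar> \<longleftrightarrow> \<bar>x\<bar> = \<bar>y\<bar>"
  using signed_permsD(2,3)[OF assms] by (metis abs_eq_iff inj_eq)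

text \<open>The position of the value 1 or -1 is where \<open>rot\<close> wraps around, so both the
  sign change and the change of \<open>fmaj\<close> are located there.\<close>

lemma signed_perms_obtain_unit:
  assumes "\<beta> \<in> signed_perms n" "n \<ge> 1"
  obtains p where "1 \<le> p" "p \<le> n" "\<bar>\<beta> (int p)\<bar> = 1"
proof -
  have "1 \<in> \<beta> ` ({- int n..int n} - {0})"
    using permutes_image[OF signed_permsD(1)[OF assms(1)]] assms(2) by auto
  then obtain x where x: "x \<in> {- int n..int n} - {0}" "\<beta> x = 1" by (metis imageE)
  show ?thesis
  proof (rule that[of "nat \<bar>x\<bar>"])
    show "\<bar>\<beta> (int (nat \<bar>x\<bar>))\<bar> = 1"
      using signed_perms_abs_eq_iff[OF assms(1), of "\<bar>x\<bar>" x] x(2) by simp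
  qed (use x in auto)
qed

lemma finite_signed_perms: "finite (signed_perms n)"
  by (rule finite_subset[OF _ finite_permutations[of "{- int n..int n} - {0}"]])
    (auto simp: signed_perms_def)

lemma signed_perms_comp:
  assumes "\<beta> \<in> signed_perms n" "\<tau> \<in> signed_perms n"
  shows "\<tau> \<circ> \<beta> \<in> signed_perms n"
  using assms by (auto simp: signed_perms_def permutes_compose)

lemma signed_perms_inv:
  assumes "\<beta> \<in> signed_perms n"
  shows "inv \<beta> \<in> signed_perms n"
proof -
  have "inv \<beta> (- i) = - inv \<beta> i" for i
    using signed_permsD[OF assms]
    by (metis permutes_inverses(1) permutes_inverses(2))
  then show ?thesis
    using permutes_inv[OF signed_permsD(1)[OF assms]] by (simp add: signed_perms_def)
qed

lemma signed_perms_0: "signed_perms 0 = {id}"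
  by (auto simp: signed_perms_def)

text \<open>Oddness forces -n to be fixed along with n. As signed permutations are functions on all
  integers, the smaller group is literally a subset of the larger one, with no restriction
  map.\<close>

lemma signed_perms_fix_last:
  assumes "n \<ge> 1"
  shows "{\<beta> \<in> signed_perms n. \<beta> (int n) = int n} = signed_perms (n - 1)"
proof (intro equalityI subsetI)
  fix \<beta> assume "\<beta> \<in> {\<beta> \<in> signed_perms n. \<beta> (int n) = int n}"
  then have \<beta>: "\<beta> \<in> signed_perms n" "\<beta> (int n) = int n" by auto
  then have "\<beta> (- int n) = - int n" using signed_permsD(2) by metis
  then have "\<beta> x = x" if "x \<in> ({- int n..int n} - {0}) - ({- int (n - 1)..int (n - 1)} - {0})" for x
  proof -
    have "x = int n \<or> x = - int n" using that assms by auto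
    then show ?thesis using \<beta>(2) \<open>\<beta> (- int n) = - int n\<close> by auto
  qed
  then have "\<beta> permutes ({- int (n - 1)..int (n - 1)} - {0})"
    using permutes_superset[OF signed_permsD(1)[OF \<beta>(1)]] by blast
  then show "\<beta> \<in> signed_perms (n - 1)"
    using \<beta> by (simp add: signed_perms_def)
next
  fix \<beta> assume \<beta>: "\<beta> \<in> signed_perms (n - 1)"
  have "\<beta> permutes ({- int n..int n} - {0})"
    by (rule permutes_subset[OF signed_permsD(1)[OF \<beta>]]) auto
  moreover have "\<beta> (int n) = int n"
    by (rule permutes_not_in[OF signed_permsD(1)[OF \<beta>]]) (use assms in auto)
  ultimately show "\<beta> \<in> {\<beta> \<in> signed_perms n. \<beta> (int n) = int n}"
    using \<beta> by (simp add: signed_perms_def)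
qed

section \<open>The sign\<close>

definition position_pairs :: "nat \<Rightarrow> (nat \<times> nat) set" where
  "position_pairs n = {(i, j). 1 \<le> i \<and> i < j \<and> j \<le> n}"

text \<open>This is the sign of the permutation \<open>\<bar>\<beta>\<bar>\<close> of the positions.
  The product form lets signs be compared pair by pair.\<close>

definition abs_sign :: "nat \<Rightarrow> (int \<Rightarrow> int) \<Rightarrow> 'a::comm_ring_1" where
  "abs_sign n \<beta> =
    (\<Prod>(i, j)\<in>position_pairs n. if \<bar>\<beta> (int i)\<bar> > \<bar>\<beta> (int j)\<bar> then - 1 else 1)"

lemma finite_position_pairs: "finite (position_pairs n)"
  by (rule finite_subset[of _ "{..n} \<times> {..n}"]) (auto simp: position_pairs_def)

lemma minus_one_power_card:
  assumes "finite A"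
  shows "(- 1 :: 'a::comm_ring_1) ^ card {x \<in> A. P x} = (\<Prod>x\<in>A. if P x then - 1 else 1)"
  using assms by (simp add: prod.If_cases Int_def)

text \<open>Listing each two-element set with its smaller position first puts \<open>N2\<close> on
  the same index set as the inversions.\<close>

lemma N2_eq_card_pairs:
  "N2 n \<beta> = card {(i, j) \<in> position_pairs n. \<beta> (int i) + \<beta> (int j) < 0}"
proof -
  let ?A = "{(i, j) \<in> position_pairs n. \<beta> (int i) + \<beta> (int j) < 0}"
  have "bij_betw (\<lambda>(i, j). {i, j}) ?A
    {{i, j} | i j. i \<in> {1..n} \<and> j \<in> {1..n} \<and> i \<noteq> j \<and> \<beta> (int i) + \<beta> (int j) < 0}"
  proof (rule bij_betw_imageI)
    show "inj_on (\<lambda>(i, j). {i, j}) ?A"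
      by (auto simp: inj_on_def position_pairs_def doubleton_eq_iff)
    show "(\<lambda>(i, j). {i, j}) ` ?A =
      {{i, j} | i j. i \<in> {1..n} \<and> j \<in> {1..n} \<and> i \<noteq> j \<and> \<beta> (int i) + \<beta> (int j) < 0}" (is "?L = ?R")
    proof (intro equalityI subsetI)
      fix s assume "s \<in> ?L"
      then show "s \<in> ?R" by (fastforce simp: position_pairs_def)
    next
      fix s assume "s \<in> ?R"
      then obtain i j where ij: "s = {i, j}" "i \<in> {1..n}" "j \<in> {1..n}" "i \<noteq> j"
        "\<beta> (int i) + \<beta> (int j) < 0" by auto
      show "s \<in> ?L"
      proof (cases "i < j")
        case True
        then show ?thesis
          using ij by (intro image_eqI[of _ _ "(i, j)"]) (auto simp: position_pairs_def)
      next
        case False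
        then show ?thesis
          using ij by (intro image_eqI[of _ _ "(j, i)"]) (auto simp: position_pairs_def)
      qed
    qed
  qed
  then show ?thesis unfolding N2_def using bij_betw_same_card by fastforce
qed

text \<open>For entries a, b at positions i < j with distinct absolute values, exactly one of a > b
  and a + b < 0 holds if |a| > |b|; otherwise both hold (b < 0) or neither does (b > 0). So the two
  signs of a pair multiply to its factor in \<open>abs_sign\<close>.\<close>

lemma minus_one_power_length_D:
  assumes "\<beta> \<in> signed_perms n"
  shows "(- 1 :: 'a::comm_ring_1) ^ length_D n \<beta> = abs_sign n \<beta>"
proof -
  have "inv_count n \<beta> = card {x \<in> position_pairs n. \<beta> (int (fst x)) > \<beta> (int (snd x))}"
    unfolding inv_count_def position_pairs_def by (rule arg_cong[of _ _ card]) auto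
  moreover have "N2 n \<beta> = card {x \<in> position_pairs n. \<beta> (int (fst x)) + \<beta> (int (snd x)) < 0}"
    unfolding N2_eq_card_pairs by (rule arg_cong[of _ _ card]) auto
  ultimately show ?thesis
    unfolding length_D_def abs_sign_def
  proof (simp only: power_add minus_one_power_card[OF finite_position_pairs] prod.distrib[symmetric],
      intro prod.cong refl)
    fix x assume "x \<in> position_pairs n"
    then obtain i j where x: "x = (i, j)" "1 \<le> i" "i < j" "j \<le> n"
      by (auto simp: position_pairs_def)
    have "\<bar>\<beta> (int i)\<bar> \<noteq> \<bar>\<beta> (int j)\<bar>"
      using signed_perms_abs_eq_iff[OF assms] x by simp
    then show "(if \<beta> (int (fst x)) > \<beta> (int (snd x)) then - 1 else 1 :: 'a) *
        (if \<beta> (int (fst x)) + \<beta> (int (snd x)) < 0 then - 1 else 1) =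
      (case x of (i, j) \<Rightarrow> if \<bar>\<beta> (int i)\<bar> > \<bar>\<beta> (int j)\<bar> then - 1 else 1)"
      using x by auto
  qed
qed

lemma abs_sign_cong:
  assumes "\<And>i. 1 \<le> i \<Longrightarrow> i \<le> n \<Longrightarrow> \<bar>\<beta> (int i)\<bar> = \<bar>\<gamma> (int i)\<bar>"
  shows "abs_sign n \<beta> = abs_sign n \<gamma>"
  unfolding abs_sign_def by (rule prod.cong) (auto simp: position_pairs_def assms)

text \<open>The extra pairs are those ending at position n, where the entry n has maximal absolute
  value, so each contributes 1.\<close>

lemma abs_sign_fix_last:
  assumes "n \<ge> 1" "\<beta> \<in> signed_perms n" "\<beta> (int n) = int n"
  shows "abs_sign n \<beta> = (abs_sign (n - 1) \<beta> :: 'a::comm_ring_1)"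
  unfolding abs_sign_def
proof (rule prod.mono_neutral_right[OF finite_position_pairs])
  show "position_pairs (n - 1) \<subseteq> position_pairs n" by (auto simp: position_pairs_def)
  show "\<forall>x\<in>position_pairs n - position_pairs (n - 1).
    (case x of (i, j) \<Rightarrow> if \<bar>\<beta> (int i)\<bar> > \<bar>\<beta> (int j)\<bar> then - 1 else 1) = (1 :: 'a)"
  proof
    fix x assume "x \<in> position_pairs n - position_pairs (n - 1)"
    then obtain i where "x = (i, n)" "1 \<le> i" "i \<le> n"
      by (cases x) (force simp: position_pairs_def)
    then show "(case x of (i, j) \<Rightarrow> if \<bar>\<beta> (int i)\<bar> > \<bar>\<beta> (int j)\<bar> then - 1 else 1) = (1 :: 'a)"
      using signed_perms_window(2)[OF assms(2), of i] assms(3) by auto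
  qed
qed

lemma card_position_pairs_through:
  assumes "1 \<le> p" "p \<le> n"
  shows "card {x \<in> position_pairs n. fst x = p \<or> snd x = p} = n - 1"
proof -
  have "{x \<in> position_pairs n. fst x = p \<or> snd x = p} =
      (\<lambda>i. (min i p, max i p)) ` ({1..n} - {p})"
    using assms by (auto simp: position_pairs_def image_iff min_def max_def)
      (force split: if_splits)+
  moreover have "inj_on (\<lambda>i. (min i p, max i p)) ({1..n} - {p})"
    by (auto simp: inj_on_def min_def max_def split: if_splits)
  ultimately show ?thesis using assms by (simp add: card_image)
qed

section \<open>Rotation of values\<close>

text \<open>One step down in \<prec>, with the minimum -1 wrapping to the maximum n. For n \<ge> 1
  it fixes everything outside the window values, so it is itself a signed permutation and acts by
  composition on the left.\<close>

definition rot :: "nat \<Rightarrow> int \<Rightarrow> int" where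
  "rot n v = (if v = 1 then - int n else if v = - 1 then int n
    else if 1 < \<bar>v\<bar> \<and> \<bar>v\<bar> \<le> int n then v - sgn v else v)"

lemma rot_cases:
  assumes "v \<noteq> 0" "\<bar>v\<bar> \<le> int n"
  obtains "v = 1" "rot n v = - int n" | "v = - 1" "rot n v = int n"
    | "1 < v" "rot n v = v - 1" | "v < - 1" "rot n v = v + 1"
  using assms by (cases "v = 1 \<or> v = - 1 \<or> v > 1") (auto simp: rot_def)

lemma rot_in_signed_perms:
  assumes "n \<ge> 1"
  shows "rot n \<in> signed_perms n"
proof -
  let ?S = "{- int n..int n} - {0}"
  have "inj_on (rot n) ?S"
    by (auto simp: inj_on_def rot_def sgn_if split: if_splits)
  moreover have "rot n ` ?S \<subseteq> ?S"
    using assms by (auto simp: rot_def sgn_if split: if_splits)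
  ultimately have "bij_betw (rot n) ?S ?S"
    by (intro bij_betw_imageI) (simp_all add: endo_inj_surj)
  moreover have "rot n x = x" if "x \<notin> ?S" for x
    using that assms by (auto simp: rot_def)
  ultimately have "rot n permutes ?S" by (rule bij_imp_permutes)
  moreover have "rot n (- v) = - rot n v" for v
    by (auto simp: rot_def)
  ultimately show ?thesis by (simp add: signed_perms_def)
qed

text \<open>On absolute values \<open>rot\<close> is the cycle sending k to k - 1 and 1 to n, so
  only comparisons involving 1 are reversed.\<close>

lemma abs_rot_greater_iff:
  assumes "a \<noteq> 0" "b \<noteq> 0" "\<bar>a\<bar> \<le> int n" "\<bar>b\<bar> \<le> int n" "\<bar>a\<bar> \<noteq> \<bar>b\<bar>"
  shows "\<bar>rot n a\<bar> > \<bar>rot n b\<bar> \<longleftrightarrow> (\<bar>a\<bar> > \<bar>b\<bar>) \<noteq> (\<bar>a\<bar> = 1 \<or> \<bar>b\<bar> = 1)"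
  by (rule rot_cases[OF assms(1,3)]; rule rot_cases[OF assms(2,4)]) (use assms in auto)

lemma rot_prec_iff:
  assumes "a \<noteq> 0" "b \<noteq> 0" "\<bar>a\<bar> \<le> int n" "\<bar>b\<bar> \<le> int n" "\<bar>a\<bar> \<noteq> \<bar>b\<bar>" "a \<noteq> - 1" "b \<noteq> - 1"
  shows "rot n a \<prec> rot n b \<longleftrightarrow> a \<prec> b"
  by (rule rot_cases[OF assms(1,3)]; rule rot_cases[OF assms(2,4)])
    (use assms in \<open>auto simp: prec_def\<close>)

text \<open>The value -1 is the minimum of \<prec> and is sent to the maximum n.\<close>

lemma rot_prec_top:
  assumes "a \<noteq> 0" "\<bar>a\<bar> \<le> int n" "\<bar>a\<bar> \<noteq> 1"
  shows "rot n a \<prec> rot n (- 1)" "\<not> rot n (- 1) \<prec> rot n a" "- 1 \<prec> a" "\<not> a \<prec> - 1"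
  by (rule rot_cases[OF assms(1,2)]; use assms in \<open>auto simp: prec_def rot_def[of n "- 1"]\<close>)+

text \<open>Exactly the pairs through the position p of the value 1 or -1 change their factor, and
  there are n - 1 of them, one for each other position.\<close>

lemma abs_sign_rot:
  assumes "n \<ge> 1" "\<beta> \<in> signed_perms n"
  shows "abs_sign n (rot n \<circ> \<beta>) = (- 1 :: 'a::comm_ring_1) ^ (n - 1) * abs_sign n \<beta>"
proof -
  obtain p where p: "1 \<le> p" "p \<le> n" "\<bar>\<beta> (int p)\<bar> = 1"
    using signed_perms_obtain_unit[OF assms(2,1)] .
  have unit: "\<bar>\<beta> (int i)\<bar> = 1 \<longleftrightarrow> i = p" for i
    using signed_perms_abs_eq_iff[OF assms(2), of "int i" "int p"] p by simp
  have "abs_sign n (rot n \<circ> \<beta>) = (\<Prod>x\<in>position_pairs n.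
      (if fst x = p \<or> snd x = p then - 1 else 1 :: 'a) *
      (case x of (i, j) \<Rightarrow> if \<bar>\<beta> (int i)\<bar> > \<bar>\<beta> (int j)\<bar> then - 1 else 1))"
    unfolding abs_sign_def
  proof (intro prod.cong refl, clarify)
    fix i j assume "(i, j) \<in> position_pairs n"
    then have ij: "1 \<le> i" "i < j" "j \<le> n" by (auto simp: position_pairs_def)
    have "\<bar>rot n (\<beta> (int i))\<bar> > \<bar>rot n (\<beta> (int j))\<bar> \<longleftrightarrow>
        (\<bar>\<beta> (int i)\<bar> > \<bar>\<beta> (int j)\<bar>) \<noteq> (i = p \<or> j = p)"
      using abs_rot_greater_iff[of "\<beta> (int i)" "\<beta> (int j)" n] unit
        signed_perms_window[OF assms(2)] ij signed_perms_abs_eq_iff[OF assms(2), of "int i" "int j"]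
      by auto
    then show "(if \<bar>(rot n \<circ> \<beta>) (int i)\<bar> > \<bar>(rot n \<circ> \<beta>) (int j)\<bar> then - 1 else 1 :: 'a) =
      (if fst (i, j) = p \<or> snd (i, j) = p then - 1 else 1) *
      (if \<bar>\<beta> (int i)\<bar> > \<bar>\<beta> (int j)\<bar> then - 1 else 1)"
      by auto
  qed
  then show ?thesis
    by (simp add: prod.distrib minus_one_power_card[OF finite_position_pairs, symmetric]
        card_position_pairs_through[OF p(1,2)] abs_sign_def)
qed

text \<open>If the value 1 occurs, it becomes -n: descents stay and \<open>N1\<close> grows by one.
  If -1 occurs at p, it becomes n: \<open>N1\<close> drops by one while \<open>maj\<close> grows by
  one, a net change of 2 - 1. The second case requires p < n, so that p can be a descent, which is
  what the assumption on the last entry ensures.\<close>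

lemma fmaj_rot:
  assumes "n \<ge> 1" and \<beta>: "\<beta> \<in> signed_perms n" and last: "\<beta> (int n) \<noteq> - 1"
  shows "fmaj n (rot n \<circ> \<beta>) = Suc (fmaj n \<beta>)"
proof -
  let ?\<gamma> = "rot n \<circ> \<beta>"
  obtain p where p: "1 \<le> p" "p \<le> n" "\<bar>\<beta> (int p)\<bar> = 1"
    using signed_perms_obtain_unit[OF \<beta> assms(1)] .
  have unit: "\<bar>\<beta> (int i)\<bar> = 1 \<longleftrightarrow> i = p" for i
    using signed_perms_abs_eq_iff[OF \<beta>, of "int i" "int p"] p by simp
  have neq: "\<bar>\<beta> (int i)\<bar> \<noteq> \<bar>\<beta> (int j)\<bar>" if "i \<noteq> j" for i j
    using signed_perms_abs_eq_iff[OF \<beta>] that by simp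
  note win = signed_perms_window[OF \<beta>]
  have neg: "rot n (\<beta> (int i)) < 0 \<longleftrightarrow> \<beta> (int i) < 0" if "i \<noteq> p" for i
    using unit[of i] that by (auto simp: rot_def sgn_if)
  have fin: "finite (Des n \<beta>)" by (rule finite_subset[of _ "{..n}"]) (auto simp: Des_def)
  consider "\<beta> (int p) = 1" | "\<beta> (int p) = - 1" using p(3) by linarith
  then show ?thesis
  proof cases
    case 1
    have ne: "\<beta> (int i) \<noteq> - 1" for i using unit[of i] 1 by auto
    have "Des n ?\<gamma> = Des n \<beta>"
      unfolding Des_def
    proof (intro Collect_cong conj_cong refl)
      fix i assume "1 \<le> i" "i < n"
      then show "?\<gamma> (int (i + 1)) \<prec> ?\<gamma> (int i) \<longleftrightarrow> \<beta> (int (i + 1)) \<prec> \<beta> (int i)"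
        using rot_prec_iff[of "\<beta> (int (i + 1))" "\<beta> (int i)" n] win[of i] win[of "i + 1"]
          neq[of "i + 1" i] ne[of i] ne[of "i + 1"] by simp
    qed
    moreover have "rot n (\<beta> (int i)) < 0 \<longleftrightarrow> i = p \<or> \<beta> (int i) < 0" for i
      using neg[of i] 1 assms(1) by (cases "i = p") (simp_all add: rot_def)
    then have "{i \<in> {1..n}. ?\<gamma> (int i) < 0} = insert p {i \<in> {1..n}. \<beta> (int i) < 0}"
      using p by auto
    ultimately show ?thesis
      using 1 by (simp add: fmaj_def maj_def N1_def)
  next
    case 2
    with last p have "p < n" by (cases "p = n") auto
    have top: "rot n (\<beta> (int i)) \<prec> rot n (\<beta> (int p))" "\<not> rot n (\<beta> (int p)) \<prec> rot n (\<beta> (int i))"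
        "\<beta> (int p) \<prec> \<beta> (int i)" "\<not> \<beta> (int i) \<prec> \<beta> (int p)" if "1 \<le> i" "i \<le> n" "i \<noteq> p" for i
      using rot_prec_top[of "\<beta> (int i)" n] win[of i] unit[of i] that 2 by auto
    have "\<beta> (int i) < 0 \<longleftrightarrow> i = p \<or> rot n (\<beta> (int i)) < 0" for i
      using neg[of i] 2 by (cases "i = p") simp_all
    then have "{i \<in> {1..n}. \<beta> (int i) < 0} = insert p {i \<in> {1..n}. ?\<gamma> (int i) < 0}"
      using p by auto
    then have N1: "N1 n \<beta> = Suc (N1 n ?\<gamma>)"
      using 2 by (simp add: N1_def rot_def[of n "- 1"])
    \<comment> \<open>Only the comparisons at p - 1 and p involve the wrapped entry. The minimum at
      p makes p - 1 a descent and p a non-descent; the maximum does the opposite. Writing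
      \<open>i + 1 \<noteq> p\<close> avoids truncated subtraction.\<close>
    have step: "i \<in> Des n ?\<gamma> \<longleftrightarrow> i = p \<or> (i \<in> Des n \<beta> \<and> i + 1 \<noteq> p)" for i
    proof (cases "1 \<le> i \<and> i < n")
      case True
      consider "i = p" | "i + 1 = p" | "i \<noteq> p" "i + 1 \<noteq> p" by blast
      then show ?thesis
      proof cases
        case 1
        then show ?thesis using top(1)[of "i + 1"] True by (simp add: Des_def)
      next
        case 2
        then have "\<not> ?\<gamma> (int (i + 1)) \<prec> ?\<gamma> (int i)"
          using top(2)[of i] True by (simp only: o_apply) simp
        then show ?thesis using 2 by (simp add: Des_def)
      next
        case 3
        then have "\<beta> (int i) \<noteq> - 1" "\<beta> (int (i + 1)) \<noteq> - 1"
          using unit[of i] unit[of "i + 1"] by fastforce+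
        then show ?thesis
          using rot_prec_iff[of "\<beta> (int (i + 1))" "\<beta> (int i)" n] win[of i] win[of "i + 1"]
            neq[of "i + 1" i] True 3 by (simp add: Des_def)
      qed
    next
      case False
      then show ?thesis using p \<open>p < n\<close> by (auto simp: Des_def)
    qed
    have pD: "p \<notin> Des n \<beta>"
      using top(4)[of "p + 1"] \<open>p < n\<close> by (auto simp: Des_def)
    have "maj n ?\<gamma> = Suc (maj n \<beta>)"
    \<comment> \<open>For p = 1 no descent is lost and the new descent 1 contributes 1; for p > 1
      the descent p - 1 is replaced by p.\<close>
    proof (cases "p = 1")
      case True
      moreover have "0 \<notin> Des n \<beta>" by (simp add: Des_def)
      ultimately have "Des n ?\<gamma> = insert p (Des n \<beta>)"
        by (intro set_eqI) (auto simp: step intro!: gr0I)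
      then show ?thesis using fin pD True by (simp add: maj_def)
    next
      case False
      have mem: "p - 1 \<in> Des n \<beta>"
        using top(3)[of "p - 1"] False p by (auto simp: Des_def)
      have "Des n ?\<gamma> = insert p (Des n \<beta> - {p - 1})"
        using p by (intro set_eqI) (auto simp: step)
      then show ?thesis
        using fin pD p sum.remove[OF fin mem, of "\<lambda>i. i"] by (simp add: maj_def)
    qed
    then show ?thesis using N1 by (simp add: fmaj_def)
  qed
qed

text \<open>The entry n is the maximum of \<prec> and is positive, so n - 1 is not a descent and
  position n does not count in \<open>N1\<close>.\<close>

lemma fmaj_fix_last:
  assumes "n \<ge> 1" and \<beta>: "\<beta> \<in> signed_perms n" and last: "\<beta> (int n) = int n"
  shows "fmaj n \<beta> = fmaj (n - 1) \<beta>"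
proof -
  have "\<not> int n \<prec> \<beta> (int i)" if "1 \<le> i" "i \<le> n" for i
    using signed_perms_window[OF \<beta> that] by (auto simp: prec_def)
  then have "Des n \<beta> = Des (n - 1) \<beta>"
    unfolding Des_def
  proof (intro Collect_cong)
    fix i
    show "1 \<le> i \<and> i < n \<and> \<beta> (int (i + 1)) \<prec> \<beta> (int i) \<longleftrightarrow>
        1 \<le> i \<and> i < n - 1 \<and> \<beta> (int (i + 1)) \<prec> \<beta> (int i)"
      using \<open>\<And>i. 1 \<le> i \<Longrightarrow> i \<le> n \<Longrightarrow> \<not> int n \<prec> \<beta> (int i)\<close>[of i] last
      by (cases "i + 1 = n") auto
  qed
  moreover have "{i \<in> {1..n}. \<beta> (int i) < 0} = {i \<in> {1..n - 1}. \<beta> (int i) < 0}"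
    using last by (auto simp: le_less)
  ultimately show ?thesis by (simp add: fmaj_def maj_def N1_def)
qed

section \<open>Summation over the last value\<close>

definition signed_weight :: "'a::comm_ring_1 \<Rightarrow> nat \<Rightarrow> (int \<Rightarrow> int) \<Rightarrow> 'a" where
  "signed_weight q n \<beta> = abs_sign n \<beta> * q ^ fmaj n \<beta>"

definition last_value_sum :: "'a::comm_ring_1 \<Rightarrow> nat \<Rightarrow> int \<Rightarrow> 'a" where
  "last_value_sum q n v = sum (signed_weight q n) {\<beta> \<in> signed_perms n. \<beta> (int n) = v}"

text \<open>Left composition with \<open>rot n\<close> is a bijection between the two index sets;
  each weight gains the factor \<open>(- 1) ^ (n - 1)\<close> from the sign and q from
  \<open>fmaj\<close>.\<close>

lemma last_value_sum_rot:
  assumes "n \<ge> 1" "v \<noteq> - 1"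
  shows "last_value_sum q n (rot n v) = (- 1) ^ (n - 1) * q * last_value_sum q n v"
proof -
  note rot = rot_in_signed_perms[OF assms(1)]
  note perm = signed_permsD(1)[OF rot]
  have "last_value_sum q n (rot n v) =
      (\<Sum>\<beta>\<in>{\<beta> \<in> signed_perms n. \<beta> (int n) = v}. signed_weight q n (rot n \<circ> \<beta>))"
    unfolding last_value_sum_def
  proof (rule sum.reindex_bij_witness[of _ "\<lambda>\<beta>. rot n \<circ> \<beta>" "\<lambda>\<beta>. inv (rot n) \<circ> \<beta>"])
    fix \<beta>
    assume "\<beta> \<in> {\<beta> \<in> signed_perms n. \<beta> (int n) = rot n v}"
    then show "inv (rot n) \<circ> \<beta> \<in> {\<beta> \<in> signed_perms n. \<beta> (int n) = v}"
      using signed_perms_comp signed_perms_inv rot permutes_inverses(2)[OF perm] by auto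
  next
    fix \<beta>
    assume "\<beta> \<in> {\<beta> \<in> signed_perms n. \<beta> (int n) = v}"
    then show "rot n \<circ> \<beta> \<in> {\<beta> \<in> signed_perms n. \<beta> (int n) = rot n v}"
      using signed_perms_comp rot by auto
  qed (simp_all add: o_assoc permutes_inv_o[OF perm])
  also have "\<dots> = (- 1) ^ (n - 1) * q * last_value_sum q n v"
    unfolding last_value_sum_def sum_distrib_left
    using assms by (intro sum.cong) (auto simp: signed_weight_def abs_sign_rot fmaj_rot algebra_simps)
  finally show ?thesis .
qed

lemma last_value_sum_top:
  assumes "n \<ge> 1"
  shows "last_value_sum q n (int n) = sum (signed_weight q (n - 1)) (signed_perms (n - 1))"
proof -
  have "last_value_sum q n (int n) =
      sum (signed_weight q (n - 1)) {\<beta> \<in> signed_perms n. \<beta> (int n) = int n}"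
    unfolding last_value_sum_def
    using assms by (intro sum.cong) (auto simp: signed_weight_def abs_sign_fix_last fmaj_fix_last)
  then show ?thesis by (simp add: signed_perms_fix_last[OF assms])
qed

text \<open>For n \<ge> 1 and k < 2n this is \<open>rot n\<close> applied k times to n: the list n,
  ..., 1, -n, ..., -1 in decreasing \<prec>-order.\<close>

definition descending_value :: "nat \<Rightarrow> nat \<Rightarrow> int" where
  "descending_value n k = (if k < n then int n - int k else int k - 2 * int n)"

lemma last_value_sum_descending:
  assumes "n \<ge> 1" "k < 2 * n"
  shows "last_value_sum q n (descending_value n k) =
    ((- 1) ^ (n - 1) * q) ^ k * last_value_sum q n (int n)"
  using assms(2)
proof (induction k)
  case 0
  then show ?case using assms(1) by (simp add: descending_value_def)
next
  case (Suc k)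
  \<comment> \<open>The value -1 is reached only at index 2n - 1, and here k < 2n - 1.\<close>
  have "descending_value n (Suc k) = rot n (descending_value n k)" "descending_value n k \<noteq> - 1"
    using Suc.prems assms(1) by (auto simp: descending_value_def rot_def sgn_if)
  then show ?case
    using Suc last_value_sum_rot[OF assms(1), of "descending_value n k" q] by (simp add: mult.assoc)
qed

text \<open>The sums over fixed last values form a geometric progression, whence the factor
  \<open>q_int\<close>. Taking k = 2n allows every last value; k = n allows exactly the positive
  ones.\<close>

lemma sum_by_last_value:
  assumes "n \<ge> 1" "k \<le> 2 * n"
  shows "sum (signed_weight q n) {\<beta> \<in> signed_perms n. \<beta> (int n) \<in> descending_value n ` {..<k}} =
    q_int ((- 1) ^ (n - 1) * q) k * sum (signed_weight q (n - 1)) (signed_perms (n - 1))"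
proof -
  let ?B = "{\<beta> \<in> signed_perms n. \<beta> (int n) \<in> descending_value n ` {..<k}}"
  have inj: "inj_on (descending_value n) {..<k}"
    using assms by (auto simp: inj_on_def descending_value_def split: if_splits)
  have "sum (signed_weight q n) ?B =
      (\<Sum>v\<in>descending_value n ` {..<k}. sum (signed_weight q n) {\<beta> \<in> ?B. \<beta> (int n) = v})"
    by (rule sum.group[symmetric]) (auto simp: finite_signed_perms)
  also have "\<dots> = (\<Sum>i<k. last_value_sum q n (descending_value n i))"
    unfolding sum.reindex[OF inj] o_def last_value_sum_def
    by (intro sum.cong) auto
  also have "\<dots> = (\<Sum>i<k. ((- 1) ^ (n - 1) * q) ^ i * last_value_sum q n (int n))"
    using assms by (intro sum.cong) (auto simp: last_value_sum_descending)
  finally show ?thesis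
    by (simp add: q_int_def sum_distrib_right last_value_sum_top[OF assms(1)])
qed

lemma descending_value_image:
  "descending_value n ` {..<n} = {1..int n}"
  "descending_value n ` {..<2 * n} = {- int n..int n} - {0}"
proof -
  show "descending_value n ` {..<n} = {1..int n}"
  proof (intro equalityI subsetI)
    fix v assume "v \<in> {1..int n}"
    then show "v \<in> descending_value n ` {..<n}"
      by (intro image_eqI[of _ _ "nat (int n - v)"]) (auto simp: descending_value_def)
  qed (auto simp: descending_value_def)
  show "descending_value n ` {..<2 * n} = {- int n..int n} - {0}"
  proof (intro equalityI subsetI)
    fix v assume "v \<in> {- int n..int n} - {0}"
    then show "v \<in> descending_value n ` {..<2 * n}"
      \<comment> \<open>The witness inverts the two branches of
        \<open>descending_value\<close>.\<close>
      by (intro image_eqI[of _ _ "nat (if v > 0 then int n - v else 2 * int n + v)"])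
        (auto simp: descending_value_def)
  qed (auto simp: descending_value_def split: if_splits)
qed

lemma sum_signed_perms:
  "sum (signed_weight q n) (signed_perms n) = (\<Prod>i = 1..n. q_int ((- 1) ^ (i - 1) * q) (2 * i))"
proof (induction n)
  case 0
  have "position_pairs 0 = {}" "Des 0 \<beta> = {}" for \<beta>
    by (auto simp: position_pairs_def Des_def)
  then show ?case
    by (simp add: signed_perms_0 signed_weight_def abs_sign_def fmaj_def maj_def N1_def)
next
  case (Suc n)
  have "{\<beta> \<in> signed_perms (Suc n). \<beta> (int (Suc n)) \<in> {- int (Suc n)..int (Suc n)} - {0}} =
      signed_perms (Suc n)"
    using signed_perms_window[of _ "Suc n" "Suc n"] by fastforce
  then show ?case
    using sum_by_last_value[of "Suc n" "2 * Suc n" q, unfolded descending_value_image] Suc.IH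
    by (simp add: mult.commute del: mult_Suc_right of_nat_Suc)
qed

section \<open>Forgetting the last sign\<close>

text \<open>Negating the last entry is written as right composition with a group element, so that
  closure under composition applies.\<close>

definition flip_last :: "nat \<Rightarrow> (int \<Rightarrow> int) \<Rightarrow> (int \<Rightarrow> int)" where
  "flip_last n \<beta> = \<beta> \<circ> transpose (int n) (- int n)"

lemma flip_last_in_signed_perms:
  assumes "n \<ge> 1" "\<beta> \<in> signed_perms n"
  shows "flip_last n \<beta> \<in> signed_perms n"
proof -
  have "transpose (int n) (- int n) \<in> signed_perms n"
    using assms(1) by (auto simp: signed_perms_def transpose_def intro!: permutes_swap_id)
  then show ?thesis
    unfolding flip_last_def using assms(2) by (intro signed_perms_comp)
qed

lemma flip_last_flip_last [simp]: "flip_last n (flip_last n \<beta>) = \<beta>"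
  by (simp add: flip_last_def flip: o_assoc)

lemma flip_last_apply:
  assumes "\<beta> \<in> signed_perms n"
  shows "flip_last n \<beta> (int n) = - \<beta> (int n)"
  using signed_permsD(2)[OF assms] by (simp add: flip_last_def)

lemma even_N1_flip_last:
  assumes "n \<ge> 1" "\<beta> \<in> signed_perms n"
  shows "even (N1 n (flip_last n \<beta>)) \<longleftrightarrow> odd (N1 n \<beta>)"
proof -
  have N1: "N1 n \<gamma> = card {i \<in> {1..<n}. \<gamma> (int i) < 0} + (if \<gamma> (int n) < 0 then 1 else 0)" for \<gamma>
  proof -
    have "{i \<in> {1..n}. \<gamma> (int i) < 0} =
        (if \<gamma> (int n) < 0 then insert n {i \<in> {1..<n}. \<gamma> (int i) < 0} else {i \<in> {1..<n}. \<gamma> (int i) < 0})"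
      using assms(1) by (auto simp: le_less)
    then show ?thesis by (simp add: N1_def)
  qed
  have "{i \<in> {1..<n}. flip_last n \<beta> (int i) < 0} = {i \<in> {1..<n}. \<beta> (int i) < 0}"
    by (auto simp: flip_last_def transpose_def)
  then show ?thesis
    using N1[of \<beta>] N1[of "flip_last n \<beta>"] flip_last_apply[OF assms(2)]
      signed_perms_window(1)[OF assms(2), of n] assms(1) by auto
qed

lemma abs_last_eq:
  assumes "n \<ge> 1" "\<gamma> \<in> signed_perms n"
  shows "abs_last n \<gamma> = (if \<gamma> (int n) > 0 then \<gamma> else flip_last n \<gamma>)"
  using signed_permsD(2)[OF assms(2)] assms(1)
  by (auto simp: abs_last_def flip_last_def fun_eq_iff transpose_def)

lemma abs_sign_flip_last:
  assumes "\<beta> \<in> signed_perms n"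
  shows "abs_sign n (flip_last n \<beta>) = abs_sign n \<beta>"
  by (rule abs_sign_cong) (simp add: signed_perms_abs_eq_iff[OF assms] flip_last_def transpose_def)

text \<open>Flipping the last sign changes the parity of \<open>N1\<close>, so for each \<beta> with
  positive last entry exactly one of \<beta> and \<open>flip_last n \<beta>\<close> is even. The
  sign depends only on absolute values, and \<open>Dmaj\<close> is by definition \<open>fmaj\<close>
  after \<open>abs_last\<close>.\<close>

lemma sum_even_signed_perms:
  fixes q :: "'a::comm_ring_1"
  assumes "n \<ge> 1"
  shows "(\<Sum>\<gamma>\<in>even_signed_perms n. (- 1) ^ length_D n \<gamma> * q ^ Dmaj n \<gamma>) =
    sum (signed_weight q n) {\<beta> \<in> signed_perms n. \<beta> (int n) > 0}"
proof (rule sum.reindex_bij_witness[of _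
      "\<lambda>\<beta>. if even (N1 n \<beta>) then \<beta> else flip_last n \<beta>" "abs_last n"])
  fix \<gamma> assume "\<gamma> \<in> even_signed_perms n"
  then have \<gamma>: "\<gamma> \<in> signed_perms n" "even (N1 n \<gamma>)" by (auto simp: even_signed_perms_def)
  show "(if even (N1 n (abs_last n \<gamma>)) then abs_last n \<gamma> else flip_last n (abs_last n \<gamma>)) = \<gamma>"
    using abs_last_eq[OF assms \<gamma>(1)] even_N1_flip_last[OF assms \<gamma>(1)] \<gamma>(2) by simp
  show "abs_last n \<gamma> \<in> {\<beta> \<in> signed_perms n. \<beta> (int n) > 0}"
    using abs_last_eq[OF assms \<gamma>(1)] \<gamma>(1) flip_last_in_signed_perms[OF assms \<gamma>(1)]
      flip_last_apply[OF \<gamma>(1)] signed_perms_window(1)[OF \<gamma>(1), of n] assms by auto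
  have "abs_sign n (abs_last n \<gamma>) = (abs_sign n \<gamma> :: 'a)"
    using abs_last_eq[OF assms \<gamma>(1)] abs_sign_flip_last[OF \<gamma>(1), where 'a = 'a] by simp
  then show "signed_weight q n (abs_last n \<gamma>) = (- 1) ^ length_D n \<gamma> * q ^ Dmaj n \<gamma>"
    by (simp add: signed_weight_def minus_one_power_length_D[OF \<gamma>(1)] Dmaj_def)
next
  fix \<beta> assume "\<beta> \<in> {\<beta> \<in> signed_perms n. \<beta> (int n) > 0}"
  then have \<beta>: "\<beta> \<in> signed_perms n" "\<beta> (int n) > 0" by auto
  note flip = flip_last_in_signed_perms[OF assms \<beta>(1)]
  show "abs_last n (if even (N1 n \<beta>) then \<beta> else flip_last n \<beta>) = \<beta>"
    using abs_last_eq[OF assms \<beta>(1)] abs_last_eq[OF assms flip] flip_last_apply[OF \<beta>(1)] \<beta>(2) by simp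
  show "(if even (N1 n \<beta>) then \<beta> else flip_last n \<beta>) \<in> even_signed_perms n"
    using \<beta>(1) flip even_N1_flip_last[OF assms \<beta>(1)] by (simp add: even_signed_perms_def)
qed

section \<open>The product formula\<close>

lemma q_int_double: "q_int q (2 * m) = (1 + q) * q_int (q ^ 2) m"
  by (induction m) (simp_all add: q_int_def algebra_simps flip: power_mult)

text \<open>Squaring removes the sign, so the sign survives only in the linear factor.\<close>

lemma q_int_double_sign:
  "q_int ((- 1) ^ i * q) (2 * m) = (1 + (- 1) ^ i * q) * q_int (q ^ 2) m"
  by (simp add: q_int_double power_mult_distrib flip: power_mult)

text \<open>Both sides consist of m factors 1 + q and m factors 1 - q; the shift swaps the two
  within each consecutive pair.\<close>

lemma prod_alternating:
  "(\<Prod>i = 1..2 * m. 1 + (- 1) ^ (i - 1) * q) = (\<Prod>i = 1..2 * m. 1 + (- 1) ^ i * q)"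
  for q :: "'a::comm_ring_1"
  by (induction m) (simp_all add: mult_ac)

text \<open>For odd n the products have an even number of factors and the last sign is positive. For
  even n one linear factor is left over, 1 + q on the left and 1 - q on the right, and the final
  factors, 1 - q and 1 + q times the same \<open>q_int (q ^ 2) (n div 2)\<close>,
  compensate.\<close>

lemma prod_q_int_shift_sign:
  fixes q :: "'a::comm_ring_1"
  assumes "n \<ge> 1"
  shows "(\<Prod>i = 1..n - 1. q_int ((- 1) ^ (i - 1) * q) (2 * i)) * q_int ((- 1) ^ (n - 1) * q) n =
    (\<Prod>i = 1..n - 1. q_int ((- 1) ^ i * q) (2 * i)) * q_int q n"
proof (cases "even n")
  case False
  then obtain m where "n = 2 * m + 1" by (rule oddE)
  then show ?thesis
    using prod_alternating[where q = q and m = m] by (simp add: q_int_double_sign prod.distrib)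
next
  case True
  \<comment> \<open>This form splits n - 1 = 2m + 1 into an even number 2m of factors and the
    leftover one.\<close>
  then obtain m where n: "n = 2 * Suc m"
    using assms by (metis evenE mult_0_right not_one_le_zero old.nat.exhaust)
  let ?P = "\<Prod>i = 1..2 * m. 1 + (- 1) ^ i * q" and ?R = "\<Prod>i = 1..n - 1. q_int (q ^ 2) i"
  have "(\<Prod>i = 1..n - 1. q_int ((- 1) ^ (i - 1) * q) (2 * i)) = ?P * (1 + q) * ?R"
    unfolding q_int_double_sign prod.distrib prod_alternating[symmetric] by (simp add: n)
  moreover have "(\<Prod>i = 1..n - 1. q_int ((- 1) ^ i * q) (2 * i)) = ?P * (1 - q) * ?R"
    unfolding q_int_double_sign prod.distrib by (simp add: n)
  moreover have "q_int ((- 1) ^ (n - 1) * q) n = (1 - q) * q_int (q ^ 2) (Suc m)"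
    unfolding n q_int_double_sign by simp
  moreover have "q_int q n = (1 + q) * q_int (q ^ 2) (Suc m)"
    unfolding n q_int_double by simp
  ultimately show ?thesis by (simp only: mult_ac)
qed

theorem theorem4p8:
  fixes n :: nat and q :: "'a::comm_ring_1"
  assumes "n \<ge> 1"
  shows "(\<Sum>\<gamma>\<in>even_signed_perms n. (- 1) ^ length_D n \<gamma> * q ^ Dmaj n \<gamma>)
    = (\<Prod>i = 1..n - 1. q_int ((- 1) ^ i * q) (2 * i)) * q_int q n"
proof -
  \<comment> \<open>The positive last values are the first n descending values, so only
    \<open>q_int\<close> of length n appears at the top level, while the lower levels contribute
    length 2i.\<close>
  have "{\<beta> \<in> signed_perms n. \<beta> (int n) > 0} =
      {\<beta> \<in> signed_perms n. \<beta> (int n) \<in> descending_value n ` {..<n}}"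
    by (auto simp: descending_value_image dest: signed_perms_window(2)[OF _ assms order_refl])
  then show ?thesis
    using sum_by_last_value[OF assms, of n q]
    unfolding sum_even_signed_perms[OF assms] sum_signed_perms prod_q_int_shift_sign[OF assms, symmetric]
    by (simp add: mult.commute)
qed

end
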